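(* Let $p_{data}$ be a data distribution, $p(z)$ a fixed latent prior and $\gamma\ge 0$. Let $d^*$ be a decoder with $$d^* \in \arg\min_{d}\left\{ KL(p_{data}\,\|\,p_d) + \gamma H(p_d)\right\},$$ where $d$ ranges over all decoders, and let $q^*$ be the encoder $q^*(z|x) = p_{d^*}(z|x)$. Assume that for all $x$ such that $p_{data}(x)>0$ we have $p_{d^*}(x)\le \sqrt{p_{data}(x)}$. Then $(q^*,d^* )$ is a Nash equilibrium of the game in which the encoder $q$ maximizes $$L_q(q,d)=\mathbb{E}_{x\sim p_{data}}\left[W(x;q,d)\right]-\mathbb{E}_{x\sim p_d}\left[\exp(W(x;q,d))\right]$$ and the decoder $d$ maximizes $$L_d(q,d)=\mathbb{E}_{x\sim p_{data}}\left[W(x;q,d)\right]+\gamma\,\mathbb{E}_{x\sim p_d}\left[W(x;q,d)\right];$$ that is, $L_q(q^*,d^* )\ge L_q(q,d^* )$ for all encoders $q$ and $L_d(q^*,d^* )\ge L_d(q^*,d)$ for all decoders $d$.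
   Context: All distributions are discrete (data variable $x$, latent variable $z$). The setting is non-parametric: an encoder is an arbitrary conditional distribution $q=q(z|x)$, and a decoder is an arbitrary conditional distribution $d=p_d(x|z)$. The latent prior $p(z)$ is fixed. For a decoder $d$, $p_d(x)=\mathbb{E}_{z\sim p(z)}[p_d(x|z)]$ denotes the distribution of generated samples, and $p_d(z|x)$ denotes the posterior of $z$ given $x$ under the joint distribution $p(z)p_d(x|z)$ (Bayes' rule). $KL(\cdot\|\cdot)$ is the Kullback-Leibler divergence and $H(p)=-\mathbb{E}_{x\sim p}[\log p(x)]$ is the Shannon entropy. The evidence lower bound (ELBO) is $$W(x;q,d)=\mathbb{E}_{z\sim q(z|x)}\left[\log p_d(x|z)\right]-KL(q(z|x)\,\|\,p(z)).$$ Expectations over generated samples (draw $z\sim p(z)$, then $x\sim p_d(x|z)$) are expectations over $x\sim p_d$. *)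

theory Defs
  imports "HOL-Probability.Probability"
begin

text \<open>
  Discrete distributions are probability mass functions, on a finite or countably infinite support.
  Divergences, entropies and expected log-likelihoods may then be infinite, so all objectives take
  values in the extended reals.
\<close>

definition eln :: "ereal \<Rightarrow> ereal" where
  "eln a = (if a \<le> 0 then - \<infinity> else if a = \<infinity> then \<infinity> else ereal (ln (real_of_ereal a)))"

definition eexp :: "ereal \<Rightarrow> ereal" where
  "eexp a = (if a = - \<infinity> then 0 else if a = \<infinity> then \<infinity> else ereal (exp (real_of_ereal a)))"

text \<open>
  The expectation is the integral of the positive part minus the integral of the negative part
  (\<^const>\<open>e2ennreal\<close> truncates negative numbers to 0). In the definitions below, at most one of
  the two integrals is infinite.
\<close>

definition expect :: "'a pmf \<Rightarrow> ('a \<Rightarrow> ereal) \<Rightarrow> ereal" where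
  "expect p f =
     enn2ereal (\<integral>\<^sup>+ x. e2ennreal (f x) \<partial>measure_pmf p)
     - enn2ereal (\<integral>\<^sup>+ x. e2ennreal (- f x) \<partial>measure_pmf p)"

lemma expect_eq_expectation:
  fixes f :: "'a \<Rightarrow> real"
  assumes "integrable (measure_pmf p) f"
  shows "expect p (\<lambda>x. ereal (f x)) = ereal (measure_pmf.expectation p f)"
proof -
  let ?P = "\<integral>\<^sup>+ x. ennreal (f x) \<partial>measure_pmf p" and ?N = "\<integral>\<^sup>+ x. ennreal (- f x) \<partial>measure_pmf p"
  have fin: "?P \<noteq> \<infinity>" "?N \<noteq> \<infinity>"
    using assms unfolding real_integrable_def by auto
  have "enn2ereal a = ereal (enn2real a)" if "a \<noteq> \<infinity>" for a
    using that by (cases a) (auto simp: enn2ereal_ennreal)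
  then show ?thesis
    unfolding expect_def real_lebesgue_integral_def[OF assms] using fin
    by (simp flip: ennreal.abs_eq)
qed

text \<open>
  In the extended reals \<open>a / 0 = \<infinity>\<close> for \<open>a > 0\<close>, hence the divergence is infinite as soon as \<open>p\<close>
  charges a point that \<open>q\<close> does not.
\<close>

definition KL :: "'a pmf \<Rightarrow> 'a pmf \<Rightarrow> ereal" where
  "KL p q = expect p (\<lambda>x. eln (ereal (pmf p x) / ereal (pmf q x)))"

definition shannon_entropy :: "'a pmf \<Rightarrow> ereal" where
  "shannon_entropy p = - expect p (\<lambda>x. eln (ereal (pmf p x)))"

type_synonym ('x, 'z) encoder = "'x \<Rightarrow> 'z pmf"
type_synonym ('x, 'z) decoder = "'z \<Rightarrow> 'x pmf"

definition generated :: "'z pmf \<Rightarrow> ('x, 'z) decoder \<Rightarrow> 'x pmf" where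
  "generated prior d = bind_pmf prior d"

text \<open>
  Bayes' rule determines the posterior only at points \<open>x\<close> that are generated with positive
  probability; elsewhere the encoder is left arbitrary.
\<close>

definition is_posterior :: "'z pmf \<Rightarrow> ('x, 'z) decoder \<Rightarrow> ('x, 'z) encoder \<Rightarrow> bool" where
  "is_posterior prior d q \<longleftrightarrow>
     (\<forall>x. pmf (generated prior d) x > 0 \<longrightarrow>
        (\<forall>z. pmf (q x) z = pmf prior z * pmf (d z) x / pmf (generated prior d) x))"

definition elbo :: "'z pmf \<Rightarrow> ('x, 'z) encoder \<Rightarrow> ('x, 'z) decoder \<Rightarrow> 'x \<Rightarrow> ereal" where
  "elbo prior q d x = expect (q x) (\<lambda>z. eln (ereal (pmf (d z) x))) - KL (q x) prior"

definition encoder_objective ::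
  "'x pmf \<Rightarrow> 'z pmf \<Rightarrow> ('x, 'z) encoder \<Rightarrow> ('x, 'z) decoder \<Rightarrow> ereal" where
  "encoder_objective pdata prior q d =
     expect pdata (elbo prior q d)
     - expect (generated prior d) (\<lambda>x. eexp (elbo prior q d x))"

definition decoder_objective ::
  "'x pmf \<Rightarrow> 'z pmf \<Rightarrow> real \<Rightarrow> ('x, 'z) encoder \<Rightarrow> ('x, 'z) decoder \<Rightarrow> ereal" where
  "decoder_objective pdata prior \<gamma> q d =
     expect pdata (elbo prior q d) + ereal \<gamma> * expect (generated prior d) (elbo prior q d)"

definition nash_equilibrium ::
  "('q \<Rightarrow> 'd \<Rightarrow> ereal) \<Rightarrow> ('q \<Rightarrow> 'd \<Rightarrow> ereal) \<Rightarrow> 'q \<Rightarrow> 'd \<Rightarrow> bool" where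
  "nash_equilibrium Lq Ld q d \<longleftrightarrow> (\<forall>q'. Lq q d \<ge> Lq q' d) \<and> (\<forall>d'. Ld q d \<ge> Ld q d')"

end

theory Submission
  imports Defs
begin

text \<open>
  The evidence lower bound at \<open>x\<close> is at most \<open>ln (p\<^sub>d x)\<close>, with equality for the posterior encoder.
  Hence the decoder objective against \<open>q\<^sup>*\<close> is at most \<open>- H(pdata) - (KL(pdata, p\<^sub>d) + \<gamma> H(p\<^sub>d))\<close>,
  with equality at \<open>d\<^sup>*\<close>. The encoder can only lower each value of the evidence lower bound, and the
  bound \<open>p\<^sub>d x \<le> sqrt (pdata x)\<close> makes its objective monotone in that value; on points that
  \<open>pdata\<close> does not charge this uses that \<open>d\<^sup>*\<close>, being a minimizer, does not generate them. If
  \<open>H(pdata)\<close> is infinite, every decoder may be a minimizer, but then both objectives are \<open>- \<infinity>\<close>.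

  Cross entropies are kept in the extended nonnegative reals, where integrals need no
  integrability assumptions; \<open>surprisal 0 = \<infinity>\<close>.
\<close>

definition surprisal :: "real \<Rightarrow> ennreal" where
  "surprisal t = e2ennreal (- eln (ereal t))"

definition cross_entropy :: "'a pmf \<Rightarrow> 'a pmf \<Rightarrow> ennreal" where
  "cross_entropy p r = (\<integral>\<^sup>+ x. surprisal (pmf r x) \<partial>measure_pmf p)"

text \<open>Positive part of the integrand of \<open>KL p r\<close>, with the negative part defined
  next. Keeping them apart lets identities be integrated by addition alone, without infinity minus
  infinity.\<close>

definition log_ratio_pos :: "'a pmf \<Rightarrow> 'a pmf \<Rightarrow> 'a \<Rightarrow> ennreal" where
  "log_ratio_pos p r x = e2ennreal (eln (ereal (pmf p x) / ereal (pmf r x)))"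

definition log_ratio_neg :: "'a pmf \<Rightarrow> 'a pmf \<Rightarrow> 'a \<Rightarrow> ennreal" where
  "log_ratio_neg p r x = e2ennreal (- eln (ereal (pmf p x) / ereal (pmf r x)))"

section \<open>Surprisal and expectations of constant sign\<close>

lemma e2ennreal_ereal [simp]: "e2ennreal (ereal a) = ennreal a"
  by (simp flip: ennreal.abs_eq)

lemma eln_ereal: "eln (ereal t) = (if t \<le> 0 then - \<infinity> else ereal (ln t))"
  by (simp add: eln_def)

lemma surprisal_zero [simp]: "surprisal 0 = \<infinity>"
  by (simp add: surprisal_def eln_ereal)

lemma surprisal_pos: "0 < t \<Longrightarrow> surprisal t = ennreal (- ln t)"
  by (simp add: surprisal_def eln_ereal)

lemma surprisal_antimono: "s \<le> t \<Longrightarrow> surprisal t \<le> surprisal s"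
  by (cases "s \<le> 0") (auto simp: surprisal_def eln_ereal intro!: ennreal_leI)

lemma eln_nonpos: "t \<le> 1 \<Longrightarrow> eln (ereal t) \<le> 0"
  by (simp add: eln_ereal)

lemma enn2ereal_surprisal:
  assumes "t \<le> 1"
  shows "enn2ereal (surprisal t) = - eln (ereal t)"
  unfolding surprisal_def using eln_nonpos[OF assms] by (simp add: enn2ereal_e2ennreal ereal_uminus_le_reorder)

lemma expect_nonpos:
  assumes "\<And>x. f x \<le> 0"
  shows "expect p f = - enn2ereal (\<integral>\<^sup>+ x. e2ennreal (- f x) \<partial>measure_pmf p)"
  using assms by (simp add: expect_def e2ennreal_neg zero_ennreal.rep_eq)

lemma expect_nonneg:
  assumes "\<And>x. 0 \<le> f x"
  shows "expect p f = enn2ereal (\<integral>\<^sup>+ x. e2ennreal (f x) \<partial>measure_pmf p)"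
proof -
  have "- f x \<le> 0" for x
    using assms[of x] by (simp add: ereal_uminus_le_reorder)
  then show ?thesis
    by (simp add: expect_def e2ennreal_neg zero_ennreal.rep_eq)
qed

lemma expect_eln:
  "expect p (\<lambda>x. eln (ereal (pmf r x))) = - enn2ereal (cross_entropy p r)"
  by (subst expect_nonpos) (auto simp: eln_nonpos pmf_le_1 cross_entropy_def surprisal_def)

lemma shannon_entropy_eq: "shannon_entropy p = enn2ereal (cross_entropy p p)"
  by (simp add: shannon_entropy_def expect_eln)

section \<open>Divergence and cross entropy\<close>

lemma log_ratio_pos_eq:
  assumes "0 < pmf p x"
  shows "log_ratio_pos p r x = (if pmf r x = 0 then \<infinity> else ennreal (ln (pmf p x / pmf r x)))"
  using assms pmf_nonneg[of r x]
  by (auto simp: log_ratio_pos_def eln_def divide_le_0_iff)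

lemma log_ratio_neg_eq:
  assumes "0 < pmf p x"
  shows "log_ratio_neg p r x = (if pmf r x = 0 then 0 else ennreal (- ln (pmf p x / pmf r x)))"
  using assms pmf_nonneg[of r x]
  by (auto simp: log_ratio_neg_def eln_def divide_le_0_iff e2ennreal_neg)

lemma KL_eq:
  "KL p r = enn2ereal (\<integral>\<^sup>+ x. log_ratio_pos p r x \<partial>measure_pmf p)
            - enn2ereal (\<integral>\<^sup>+ x. log_ratio_neg p r x \<partial>measure_pmf p)"
  by (simp add: KL_def expect_def log_ratio_pos_def log_ratio_neg_def)

text \<open>Weighting \<open>f / p\<close> by \<open>p\<close> recovers \<open>f\<close> on the
  support of \<open>p\<close> and 0 elsewhere, so mass can only be lost.\<close>

lemma nn_integral_ratio_le:
  assumes "(\<integral>\<^sup>+ x. ennreal (f x) \<partial>count_space UNIV) \<le> 1" and "\<And>x. 0 \<le> f x"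
  shows "(\<integral>\<^sup>+ x. ennreal (f x / pmf p x) \<partial>measure_pmf p) \<le> 1"
proof -
  have "ennreal (pmf p x) * ennreal (f x / pmf p x) \<le> ennreal (f x)" for x
    using assms(2)[of x] by (cases "pmf p x = 0") (auto simp flip: ennreal_mult)
  then have "(\<integral>\<^sup>+ x. ennreal (f x / pmf p x) \<partial>measure_pmf p)
      \<le> (\<integral>\<^sup>+ x. ennreal (f x) \<partial>count_space UNIV)"
    by (subst nn_integral_measure_pmf) (auto intro!: nn_integral_mono)
  with assms(1) show ?thesis by simp
qed

text \<open>By \<open>ln t \<le> t - 1\<close> at \<open>t = r / p\<close>, the negative part is at
  most \<open>r / p\<close>, whose mean under \<open>p\<close> is at most 1. So the divergence is
  never infinity minus infinity.\<close>

lemma log_ratio_neg_integral_le: "(\<integral>\<^sup>+ x. log_ratio_neg p r x \<partial>measure_pmf p) \<le> 1"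
proof -
  have "log_ratio_neg p r x \<le> ennreal (pmf r x / pmf p x)" if "x \<in> set_pmf p" for x
  proof (cases "pmf r x = 0")
    case False
    with that have pos: "0 < pmf p x" "0 < pmf r x"
      by (auto simp: pmf_positive order_le_neq_trans)
    then have "- ln (pmf p x / pmf r x) = ln (pmf r x / pmf p x)"
      by (simp add: ln_div)
    also have "\<dots> \<le> pmf r x / pmf p x"
      using ln_le_minus_one[of "pmf r x / pmf p x"] pos by simp
    finally show ?thesis
      using pos by (simp add: log_ratio_neg_eq ennreal_leI)
  qed (use that in \<open>simp add: log_ratio_neg_eq pmf_positive\<close>)
  then have "(\<integral>\<^sup>+ x. log_ratio_neg p r x \<partial>measure_pmf p)
      \<le> (\<integral>\<^sup>+ x. ennreal (pmf r x / pmf p x) \<partial>measure_pmf p)"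
    by (intro nn_integral_mono_AE) (simp add: AE_measure_pmf_iff)
  also have "\<dots> \<le> 1"
    by (rule nn_integral_ratio_le) (simp_all add: nn_integral_pmf_eq_1)
  finally show ?thesis .
qed

text \<open>Pointwise, \<open>- ln r = - ln p + ln (p / r)\<close> with the negative part of the
  last term moved to the left. Where \<open>r\<close> vanishes both sides are infinite, so no
  finiteness is assumed.\<close>

lemma cross_entropy_decomposition:
  "cross_entropy p r + (\<integral>\<^sup>+ x. log_ratio_neg p r x \<partial>measure_pmf p)
   = cross_entropy p p + (\<integral>\<^sup>+ x. log_ratio_pos p r x \<partial>measure_pmf p)"
proof -
  have "surprisal (pmf r x) + log_ratio_neg p r x = surprisal (pmf p x) + log_ratio_pos p r x"
    if "x \<in> set_pmf p" for x
  proof (cases "pmf r x = 0")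
    case False
    with that have pos: "0 < pmf p x" "0 < pmf r x"
      by (auto simp: pmf_positive order_le_neq_trans)
    moreover have "ln (pmf p x) \<le> 0" "ln (pmf r x) \<le> 0"
      using pos by (simp_all add: pmf_le_1)
    ultimately show ?thesis
      by (cases "pmf p x \<le> pmf r x")
         (simp_all add: log_ratio_neg_eq log_ratio_pos_eq surprisal_pos ln_div ennreal_neg
           flip: ennreal_plus)
  qed (use that in \<open>simp add: log_ratio_neg_eq log_ratio_pos_eq pmf_positive\<close>)
  then have "(\<integral>\<^sup>+ x. surprisal (pmf r x) + log_ratio_neg p r x \<partial>measure_pmf p)
      = (\<integral>\<^sup>+ x. surprisal (pmf p x) + log_ratio_pos p r x \<partial>measure_pmf p)"
    by (intro nn_integral_cong_AE) (simp add: AE_measure_pmf_iff)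
  then show ?thesis
    by (simp add: cross_entropy_def nn_integral_add)
qed

text \<open>The decomposition has an infinite right side, and the negative part on its left is at
  most 1.\<close>

lemma cross_entropy_eq_infinity:
  assumes "cross_entropy p p = \<infinity>"
  shows "cross_entropy p r = \<infinity>"
  using cross_entropy_decomposition[of p r] log_ratio_neg_integral_le[of p r] assms
  by (auto simp: top_unique)

lemma enn2ereal_diff_eq:
  assumes "a + n = h + b" "n \<noteq> \<infinity>" "h \<noteq> \<infinity>"
  shows "enn2ereal b - enn2ereal n = enn2ereal a - enn2ereal h"
  using assms
  by (cases a; cases b; cases n; cases h)
     (auto simp: enn2ereal_ennreal top_ennreal.rep_eq simp flip: ennreal_plus)

lemma KL_cross_entropy:
  assumes "cross_entropy p p \<noteq> \<infinity>"
  shows "KL p r = enn2ereal (cross_entropy p r) - enn2ereal (cross_entropy p p)"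
  unfolding KL_eq
  by (rule enn2ereal_diff_eq[OF cross_entropy_decomposition])
     (use assms log_ratio_neg_integral_le[of p r] in \<open>auto simp: top_unique\<close>)

section \<open>The evidence lower bound against the generated likelihood\<close>

lemma pmf_generated_nn:
  "ennreal (pmf (generated prior d) x) = (\<integral>\<^sup>+ z. ennreal (pmf prior z * pmf (d z) x) \<partial>count_space UNIV)"
  by (simp add: generated_def ennreal_pmf_bind nn_integral_measure_pmf ennreal_mult)

lemma pmf_generated_eq_0:
  assumes "pmf (generated prior d) x = 0"
  shows "pmf prior z = 0 \<or> pmf (d z) x = 0"
  using pmf_generated_nn[of prior d x] assms
  by (auto simp: nn_integral_0_iff_AE AE_count_space mult_le_0_iff)

lemma elbo_eq:
  "elbo prior q d x = - enn2ereal (\<integral>\<^sup>+ z. surprisal (pmf (d z) x) \<partial>measure_pmf (q x))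
     - (enn2ereal (\<integral>\<^sup>+ z. log_ratio_pos (q x) prior z \<partial>measure_pmf (q x))
        - enn2ereal (\<integral>\<^sup>+ z. log_ratio_neg (q x) prior z \<partial>measure_pmf (q x)))"
  unfolding elbo_def KL_eq
  by (subst expect_nonpos) (auto simp: eln_nonpos pmf_le_1 surprisal_def)

text \<open>Carries a real inequality over to \<open>ennreal\<close> when the sign of
  \<open>u\<close> is unknown: its positive part stays on the left, its negative part goes to the
  right.\<close>

lemma ennreal_split_sign_mono:
  fixes a b t u :: real
  assumes "a + u + 1 \<le> b + t" "0 \<le> a" "0 \<le> b" "0 \<le> t"
  shows "ennreal a + ennreal u + 1 \<le> ennreal b + ennreal (- u) + ennreal t"
proof (cases "0 \<le> u")
  case True
  have "ennreal (a + u + 1) \<le> ennreal (b + t)"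
    by (rule ennreal_leI) (rule assms(1))
  with True assms(2-) show ?thesis
    by (simp add: ennreal_neg)
next
  case False
  have "ennreal (a + 1) \<le> ennreal (b + - u + t)"
    by (rule ennreal_leI) (use assms(1) in simp)
  moreover have "ennreal (b + - u + t) = ennreal b + ennreal (- u) + ennreal t"
    using False assms(2-) by (simp del: add_uminus_conv_diff)
  ultimately show ?thesis
    using False assms(2-) by (simp add: ennreal_neg)
qed

text \<open>Gibbs' inequality: \<open>ln t \<le> t - 1\<close>, where \<open>t\<close> is the Bayes
  posterior divided by \<open>q\<close>, is integrated under \<open>q\<close>. The 1 on the left
  cancels the mass of the posterior, which is at most 1.\<close>

lemma elbo_le_eln: "elbo prior q d x \<le> eln (ereal (pmf (generated prior d) x))"
proof -
  let ?g = "pmf (generated prior d) x" and ?Q = "measure_pmf (q x)"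
  let ?D = "\<integral>\<^sup>+ z. surprisal (pmf (d z) x) \<partial>?Q"
  let ?P = "\<integral>\<^sup>+ z. log_ratio_pos (q x) prior z \<partial>?Q"
  let ?N = "\<integral>\<^sup>+ z. log_ratio_neg (q x) prior z \<partial>?Q"
  let ?w = "\<lambda>z. pmf prior z * pmf (d z) x / ?g"
  have pt: "surprisal ?g + log_ratio_neg (q x) prior z + 1
      \<le> surprisal (pmf (d z) x) + log_ratio_pos (q x) prior z + ennreal (?w z / pmf (q x) z)"
    if z: "z \<in> set_pmf (q x)" for z
  proof (cases "pmf prior z = 0 \<or> pmf (d z) x = 0")
    \<comment> \<open>Either the log ratio or the surprisal on the right is infinite.\<close>
    case True
    then show ?thesis
      using z by (auto simp: log_ratio_pos_eq pmf_positive)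
  next
    case False
    then have g: "0 < ?g"
      using pmf_generated_eq_0[of prior d x z] by (auto intro: order_le_neq_trans)
    from False z have pos: "0 < pmf prior z" "0 < pmf (d z) x" "0 < pmf (q x) z"
      by (auto simp: pmf_positive order_le_neq_trans)
    let ?t = "?w z / pmf (q x) z"
    have t: "0 < ?t" using pos g by simp
    have "ln ?t \<le> ?t - 1"
      by (rule ln_le_minus_one[OF t])
    then have key: "ln (pmf prior z) + ln (pmf (d z) x) - ln ?g - ln (pmf (q x) z) + 1 \<le> ?t"
      using pos g by (simp add: ln_div ln_mult)
    have nonpos: "ln ?g \<le> 0" "ln (pmf (d z) x) \<le> 0"
      using pos g by (simp_all add: pmf_le_1)
    have "ennreal (- ln ?g) + ennreal (ln (pmf prior z) - ln (pmf (q x) z)) + 1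
      \<le> ennreal (- ln (pmf (d z) x)) + ennreal (- (ln (pmf prior z) - ln (pmf (q x) z))) + ennreal ?t"
      by (rule ennreal_split_sign_mono) (use key nonpos t in auto)
    then show ?thesis
      using pos g by (simp add: log_ratio_neg_eq log_ratio_pos_eq surprisal_pos ln_div)
  qed
  have "(\<integral>\<^sup>+ z. ennreal (?w z) \<partial>count_space UNIV) \<le> 1"
  \<comment> \<open>For \<open>?g = 0\<close> division by zero makes \<open>?w\<close> vanish;
    otherwise \<open>?w\<close> has total mass 1 by Bayes' rule.\<close>
  proof (cases "?g = 0")
    case False
    then have g: "0 < ?g" by (auto intro: order_le_neq_trans)
    have "(\<integral>\<^sup>+ z. ennreal (?w z) \<partial>count_space UNIV)
        = (\<integral>\<^sup>+ z. ennreal (pmf prior z * pmf (d z) x) * ennreal (1 / ?g) \<partial>count_space UNIV)"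
      by (simp flip: ennreal_mult)
    also have "\<dots> = ennreal ?g * ennreal (1 / ?g)"
      by (simp add: nn_integral_multc pmf_generated_nn)
    also have "\<dots> = 1" using g by (simp flip: ennreal_mult)
    finally show ?thesis by simp
  qed simp
  then have W: "(\<integral>\<^sup>+ z. ennreal (?w z / pmf (q x) z) \<partial>?Q) \<le> 1"
    by (rule nn_integral_ratio_le) simp
  have "surprisal ?g + ?N + 1
      = (\<integral>\<^sup>+ z. surprisal ?g + log_ratio_neg (q x) prior z + 1 \<partial>?Q)"
    by (simp add: nn_integral_add)
  also have "\<dots> \<le> (\<integral>\<^sup>+ z. surprisal (pmf (d z) x) + log_ratio_pos (q x) prior z
      + ennreal (?w z / pmf (q x) z) \<partial>?Q)"
    by (intro nn_integral_mono_AE) (use pt in \<open>simp add: AE_measure_pmf_iff\<close>)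
  also have "\<dots> = ?D + ?P + (\<integral>\<^sup>+ z. ennreal (?w z / pmf (q x) z) \<partial>?Q)"
    by (simp add: nn_integral_add)
  also have "\<dots> \<le> ?D + ?P + 1"
    using W by (rule add_left_mono)
  finally have le: "surprisal ?g + ?N \<le> ?D + ?P"
    by (simp add: ennreal_add_left_cancel_le add.commute)
  have "?N \<noteq> \<infinity>"
    using log_ratio_neg_integral_le[of "q x" prior] by (auto simp: top_unique)
  with le have "- enn2ereal ?D - (enn2ereal ?P - enn2ereal ?N) \<le> - enn2ereal (surprisal ?g)"
    by (cases ?D; cases ?P; cases ?N; cases "surprisal ?g")
       (auto simp: enn2ereal_ennreal top_ennreal.rep_eq top_unique simp flip: ennreal_plus)
  then show ?thesis
    by (simp add: elbo_eq enn2ereal_surprisal pmf_le_1)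
qed

text \<open>For the posterior, \<open>q / prior = d / ?g\<close>, which turns the bound into a
  pointwise identity. Where nothing is generated the encoder is arbitrary, but the upper bound is
  already \<open>- \<infinity>\<close>.\<close>

lemma elbo_posterior:
  assumes "is_posterior prior d q"
  shows "elbo prior q d x = eln (ereal (pmf (generated prior d) x))"
proof (cases "pmf (generated prior d) x = 0")
  case True
  then show ?thesis
    using elbo_le_eln[of prior q d x] by (simp add: eln_ereal)
next
  case False
  let ?g = "pmf (generated prior d) x" and ?Q = "measure_pmf (q x)"
  let ?D = "\<integral>\<^sup>+ z. surprisal (pmf (d z) x) \<partial>?Q"
  let ?P = "\<integral>\<^sup>+ z. log_ratio_pos (q x) prior z \<partial>?Q"
  let ?N = "\<integral>\<^sup>+ z. log_ratio_neg (q x) prior z \<partial>?Q"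
  have g: "0 < ?g" using False by (auto intro: order_le_neq_trans)
  with assms have q: "pmf (q x) z = pmf prior z * pmf (d z) x / ?g" for z
    by (auto simp: is_posterior_def)
  have pt: "surprisal ?g + log_ratio_neg (q x) prior z
      = surprisal (pmf (d z) x) + log_ratio_pos (q x) prior z"
    if z: "z \<in> set_pmf (q x)" for z
  proof -
    have pos: "0 < pmf prior z" "0 < pmf (d z) x" "0 < pmf (q x) z"
      using q[of z] pmf_positive[OF z] by (auto intro: order_le_neq_trans)
    have ratio: "pmf (q x) z / pmf prior z = pmf (d z) x / ?g"
      using q[of z] pos by simp
    have "ln ?g \<le> 0" "ln (pmf (d z) x) \<le> 0"
      using pos g by (simp_all add: pmf_le_1)
    with pos g show ?thesis
      by (cases "pmf (d z) x \<le> ?g")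
         (simp_all add: log_ratio_neg_eq log_ratio_pos_eq ratio surprisal_pos ln_div ennreal_neg
           flip: ennreal_plus)
  qed
  have "surprisal ?g + ?N = (\<integral>\<^sup>+ z. surprisal ?g + log_ratio_neg (q x) prior z \<partial>?Q)"
    by (simp add: nn_integral_add)
  also have "\<dots> = (\<integral>\<^sup>+ z. surprisal (pmf (d z) x) + log_ratio_pos (q x) prior z \<partial>?Q)"
    by (intro nn_integral_cong_AE) (use pt in \<open>simp add: AE_measure_pmf_iff\<close>)
  also have "\<dots> = ?D + ?P"
    by (simp add: nn_integral_add)
  finally have eq: "surprisal ?g + ?N = ?D + ?P" .
  have "?N \<noteq> \<infinity>"
    using log_ratio_neg_integral_le[of "q x" prior] by (auto simp: top_unique)
  moreover have "surprisal ?g \<noteq> \<infinity>"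
    using g by (simp add: surprisal_pos)
  ultimately have "- enn2ereal ?D - (enn2ereal ?P - enn2ereal ?N) = - enn2ereal (surprisal ?g)"
    using eq by (cases ?D; cases ?P; cases ?N; cases "surprisal ?g")
       (auto simp: enn2ereal_ennreal top_ennreal.rep_eq top_unique simp flip: ennreal_plus)
  then show ?thesis
    by (simp add: elbo_eq enn2ereal_surprisal pmf_le_1)
qed

lemma elbo_nonpos: "elbo prior q d x \<le> 0"
  using elbo_le_eln[of prior q d x] eln_nonpos[OF pmf_le_1] by (rule order_trans)

lemma expect_elbo:
  "expect p (elbo prior q d) = - enn2ereal (\<integral>\<^sup>+ x. e2ennreal (- elbo prior q d x) \<partial>measure_pmf p)"
  by (rule expect_nonpos) (rule elbo_nonpos)

lemma expect_elbo_le: "expect p (elbo prior q d) \<le> - enn2ereal (cross_entropy p (generated prior d))"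
  unfolding expect_elbo cross_entropy_def surprisal_def
  by (auto simp flip: less_eq_ennreal.rep_eq intro!: nn_integral_mono e2ennreal_mono elbo_le_eln)

lemma expect_elbo_posterior:
  assumes "is_posterior prior d q"
  shows "expect p (elbo prior q d) = - enn2ereal (cross_entropy p (generated prior d))"
  unfolding expect_eln[symmetric] by (simp add: expect_def elbo_posterior[OF assms])

lemma eexp_nonneg: "0 \<le> eexp a"
  by (simp add: eexp_def)

section \<open>Support of a minimizer\<close>

text \<open>Each atom of \<open>r\<close> is at most the mass of its image.\<close>
lemma cross_entropy_map_le:
  "cross_entropy (map_pmf f r) (map_pmf f r) \<le> cross_entropy r r"
proof -
  have "pmf r x \<le> pmf (map_pmf f r) (f x)" for x
    unfolding pmf_map by (subst pmf.rep_eq) (auto intro!: measure_pmf.finite_measure_mono)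
  then show ?thesis
    by (auto simp: cross_entropy_def intro!: nn_integral_mono surprisal_antimono)
qed

text \<open>Mass of \<open>r\<close> outside the support of \<open>p\<close> can be moved onto an atom of \<open>p\<close>, which strictly lowers
  the cross entropy and does not increase the entropy.\<close>
lemma minimizer_support:
  fixes p r :: "'a pmf"
  assumes min: "\<And>s. cross_entropy p r + c * cross_entropy r r \<le> cross_entropy p s + c * cross_entropy s s"
    and fin: "cross_entropy p r + c * cross_entropy r r \<noteq> \<infinity>"
  shows "set_pmf r \<subseteq> set_pmf p"
proof (rule ccontr)
  assume "\<not> ?thesis"
  then obtain x0 where x0: "x0 \<in> set_pmf r" "x0 \<notin> set_pmf p" by blast
  obtain x1 where x1: "x1 \<in> set_pmf p" using set_pmf_not_empty[of p] by blast
  define f where "f x = (if x \<in> set_pmf p then x else x1)" for x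
  let ?s = "map_pmf f r"
  have le: "pmf r x \<le> pmf ?s x" if "x \<in> set_pmf p" for x
    unfolding pmf_map using that
    by (subst pmf.rep_eq) (auto simp: f_def intro!: measure_pmf.finite_measure_mono)
  \<comment> \<open>Both points are sent to \<open>x1\<close>, which therefore gains at least the
    positive mass of \<open>x0\<close>; this gives strictness.\<close>
  have "pmf r x1 + pmf r x0 = measure (measure_pmf r) {x1, x0}"
  proof -
    have "x1 \<noteq> x0" using x0 x1 by blast
    then show ?thesis by (simp add: measure_measure_pmf_finite)
  qed
  also have "\<dots> \<le> pmf ?s x1"
    unfolding pmf_map using x0 x1
    by (auto simp: f_def intro!: measure_pmf.finite_measure_mono)
  finally have less: "pmf r x1 < pmf ?s x1"
    using pmf_positive[OF x0(1)] by simp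
  have finX: "cross_entropy p r \<noteq> \<infinity>" "c * cross_entropy r r \<noteq> \<infinity>"
    using fin by auto
  have lt: "cross_entropy p ?s < cross_entropy p r"
    unfolding cross_entropy_def
  proof (rule nn_integral_less)
    show AE: "AE x in measure_pmf p. surprisal (pmf ?s x) \<le> surprisal (pmf r x)"
      using le by (auto simp: AE_measure_pmf_iff intro: surprisal_antimono)
    show "(\<integral>\<^sup>+ x. surprisal (pmf ?s x) \<partial>measure_pmf p) \<noteq> \<infinity>"
      using nn_integral_mono_AE[OF AE] finX(1) by (auto simp: cross_entropy_def top_unique)
    have "surprisal (pmf ?s x1) < surprisal (pmf r x1)"
    proof (cases "pmf r x1 = 0")
      case True
      then show ?thesis using less by (simp add: surprisal_pos)
    next
      case False
      then have "0 < pmf r x1" by (auto intro: order_le_neq_trans)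
      with less show ?thesis
        using pmf_le_1[of ?s x1] by (auto simp: surprisal_pos intro!: ennreal_lessI)
    qed
    then show "\<not> (AE x in measure_pmf p. surprisal (pmf r x) \<le> surprisal (pmf ?s x))"
      using x1 by (auto simp: AE_measure_pmf_iff not_le)
  qed auto
  have "c * cross_entropy ?s ?s \<le> c * cross_entropy r r"
    by (intro mult_left_mono cross_entropy_map_le) simp
  then have "cross_entropy p ?s + c * cross_entropy ?s ?s
      \<le> cross_entropy p ?s + c * cross_entropy r r"
    by (rule add_left_mono)
  \<comment> \<open>Strictness survives the addition because the entropy term is finite.\<close>
  also have "\<dots> < cross_entropy p r + c * cross_entropy r r"
    using lt finX(2) by (simp add: ennreal_add_left_cancel_less add.commute[of _ "c * cross_entropy r r"])
  finally show False
    using min[of ?s] by simp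
qed

section \<open>The best response of the encoder\<close>

text \<open>Pointwise, \<open>w \<mapsto> p w - g exp w\<close> is nondecreasing up to \<open>w = ln (p / g)\<close>, and \<open>g \<le> sqrt p\<close>
  says that this is beyond the largest possible value \<open>ln g\<close> of the evidence lower bound.\<close>
lemma encoder_pointwise_real:
  fixes p g w :: real
  assumes "0 < g" "g\<^sup>2 \<le> p" "w \<le> ln g"
  shows "p * (- ln g) + g * g \<le> p * (- w) + g * exp w"
proof -
  have e: "exp w \<le> g"
    using assms by (metis exp_le_cancel_iff exp_ln)
  \<comment> \<open>This convexity bound replaces a derivative: multiplied by \<open>p\<close>, and
    with \<open>p\<close> lowered to \<open>g\<^sup>2\<close> on the smaller side, it gives
    \<open>g * (g - exp w) \<le> p * (ln g - w)\<close>.\<close>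
  have "ln (exp w / g) \<le> exp w / g - 1"
    using assms by (intro ln_le_minus_one) simp
  then have "(g - exp w) / g \<le> ln g - w"
    using assms by (simp add: ln_div diff_divide_distrib)
  then have "p * ((g - exp w) / g) \<le> p * (ln g - w)"
    using assms by (intro mult_left_mono) (auto intro: order_trans[OF zero_le_power2])
  moreover have "g\<^sup>2 * ((g - exp w) / g) \<le> p * ((g - exp w) / g)"
    using assms e by (intro mult_right_mono) auto
  moreover have "g\<^sup>2 * ((g - exp w) / g) = g * (g - exp w)"
    using assms by (simp add: power2_eq_square)
  ultimately show ?thesis
    by (simp add: algebra_simps)
qed

text \<open>Extends the real inequality to infinite values. If \<open>p = 0\<close> then
  \<open>g = 0\<close> and the left side vanishes; if \<open>p > 0\<close> and
  \<open>W = - \<infinity>\<close> the right side is infinite.\<close>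

lemma encoder_pointwise:
  fixes p g :: real
  assumes "0 \<le> g" "g \<le> 1" "g \<le> sqrt p" "0 \<le> p" "W \<le> eln (ereal g)"
  shows "ennreal p * surprisal g + ennreal g * ennreal g
     \<le> ennreal p * e2ennreal (- W) + ennreal g * e2ennreal (eexp W)"
proof (cases "g = 0 \<or> W = - \<infinity>")
  case True
  show ?thesis
  proof (cases "p = 0")
    case True
    with assms show ?thesis by simp
  next
    case False
    from True assms(5) have "W = - \<infinity>" by (auto simp: eln_ereal)
    with False assms show ?thesis by (simp add: ennreal_mult_top)
  qed
next
  case False
  with assms have g: "0 < g" by simp
  with False assms(5) obtain w where w: "W = ereal w" "w \<le> ln g"
    by (cases W) (auto simp: eln_ereal)
  have "g\<^sup>2 \<le> p"
    using assms by (metis real_sqrt_pow2 power_mono)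
  from encoder_pointwise_real[OF g this w(2)]
  have "ennreal (p * (- ln g) + g * g) \<le> ennreal (p * (- w) + g * exp w)"
    by (rule ennreal_leI)
  moreover have "0 \<le> - ln g" using g assms(2) by simp
  moreover from this have "0 \<le> - w" using w(2) by linarith
  ultimately have "ennreal p * ennreal (- ln g) + ennreal g * ennreal g
      \<le> ennreal p * ennreal (- w) + ennreal g * ennreal (exp w)"
    using g assms(4) by (simp only: ennreal_plus ennreal_mult mult_nonneg_nonneg less_imp_le exp_ge_zero)
  then show ?thesis
    using g w(1) by (simp add: surprisal_pos eexp_def)
qed

lemma eexp_eln: "0 \<le> t \<Longrightarrow> eexp (eln (ereal t)) = ereal t"
  by (auto simp: eexp_def eln_ereal)

text \<open>Both terms of the objective are nonpositive, so it is the negative of a loss in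
  \<open>ennreal\<close>.\<close>

lemma encoder_objective_eq:
  "encoder_objective p prior q d =
     - enn2ereal ((\<integral>\<^sup>+ x. e2ennreal (- elbo prior q d x) \<partial>measure_pmf p)
       + (\<integral>\<^sup>+ x. e2ennreal (eexp (elbo prior q d x)) \<partial>measure_pmf (generated prior d)))"
proof -
  let ?A = "\<integral>\<^sup>+ x. e2ennreal (- elbo prior q d x) \<partial>measure_pmf p"
  let ?B = "\<integral>\<^sup>+ x. e2ennreal (eexp (elbo prior q d x)) \<partial>measure_pmf (generated prior d)"
  have "- enn2ereal ?A - enn2ereal ?B = - enn2ereal (?A + ?B)"
    by (cases ?A; cases ?B) (auto simp: enn2ereal_ennreal top_ennreal.rep_eq simp flip: ennreal_plus)
  then show ?thesis
    by (simp add: encoder_objective_def expect_elbo expect_nonneg eexp_nonneg)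
qed

lemma encoder_best_response:
  assumes post: "is_posterior prior d q"
    and le: "\<And>x. pmf p x > 0 \<Longrightarrow> pmf (generated prior d) x \<le> sqrt (pmf p x)"
    and supp: "cross_entropy p p \<noteq> \<infinity> \<Longrightarrow> set_pmf (generated prior d) \<subseteq> set_pmf p"
  shows "encoder_objective p prior q' d \<le> encoder_objective p prior q d"
proof -
  let ?r = "generated prior d"
  have eq: "(\<integral>\<^sup>+ x. e2ennreal (- elbo prior q d x) \<partial>measure_pmf p) = cross_entropy p ?r"
    "(\<integral>\<^sup>+ x. e2ennreal (eexp (elbo prior q d x)) \<partial>measure_pmf ?r)
       = (\<integral>\<^sup>+ x. ennreal (pmf ?r x) \<partial>measure_pmf ?r)"
    by (simp_all add: elbo_posterior[OF post] cross_entropy_def surprisal_def eexp_eln)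
  have "cross_entropy p ?r + (\<integral>\<^sup>+ x. ennreal (pmf ?r x) \<partial>measure_pmf ?r)
     \<le> (\<integral>\<^sup>+ x. e2ennreal (- elbo prior q' d x) \<partial>measure_pmf p)
       + (\<integral>\<^sup>+ x. e2ennreal (eexp (elbo prior q' d x)) \<partial>measure_pmf ?r)"
  proof (cases "cross_entropy p p = \<infinity>")
    case True
    \<comment> \<open>The loss of the competing encoder dominates a cross entropy that is infinite
      here.\<close>
    have "cross_entropy p ?r \<le> (\<integral>\<^sup>+ x. e2ennreal (- elbo prior q' d x) \<partial>measure_pmf p)"
      unfolding cross_entropy_def surprisal_def
      by (auto intro!: nn_integral_mono e2ennreal_mono elbo_le_eln)
    then show ?thesis
      using cross_entropy_eq_infinity[OF True, of ?r] by (simp add: top_unique)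
  next
    case False
    have "pmf ?r x \<le> sqrt (pmf p x)" for x
    proof (cases "pmf p x = 0")
      case True
      then have "pmf ?r x = 0" using supp[OF False] by (auto simp: set_pmf_iff)
      with True show ?thesis by simp
    qed (auto intro!: le order_le_neq_trans)
    then show ?thesis
      \<comment> \<open>Over the counting measure the integrals under \<open>p\<close> and under
        \<open>?r\<close> merge into one, where the pointwise bound applies.\<close>
      unfolding cross_entropy_def nn_integral_measure_pmf
      by (subst (1 2) nn_integral_add[symmetric])
         (auto intro!: nn_integral_mono encoder_pointwise elbo_le_eln simp: pmf_le_1)
  qed
  then show ?thesis
    by (simp add: encoder_objective_eq eq flip: less_eq_ennreal.rep_eq)
qed

section \<open>The decoder objective and the equilibrium\<close>

lemma ereal_times_enn2ereal: "0 \<le> c \<Longrightarrow> ereal c * enn2ereal a = enn2ereal (ennreal c * a)"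
  by (simp add: times_ennreal.rep_eq enn2ereal_ennreal)

text \<open>Shows that, for finite H(p), the objective that defines the minimizer is a sum of cross
  entropies up to a finite constant.\<close>

lemma KL_plus_entropy:
  assumes "cross_entropy p p \<noteq> \<infinity>" "0 \<le> \<gamma>"
  shows "KL p r + ereal \<gamma> * shannon_entropy r
    = enn2ereal (cross_entropy p r + ennreal \<gamma> * cross_entropy r r) - enn2ereal (cross_entropy p p)"
  using assms
  by (cases "cross_entropy p p"; cases "cross_entropy p r"; cases "ennreal \<gamma> * cross_entropy r r")
     (auto simp: KL_cross_entropy shannon_entropy_eq ereal_times_enn2ereal enn2ereal_ennreal
        top_ennreal.rep_eq simp flip: ennreal_plus)

lemma uminus_enn2ereal_add:
  "0 \<le> c \<Longrightarrow> - enn2ereal a + ereal c * (- enn2ereal b) = - enn2ereal (a + ennreal c * b)"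
  by (cases a; cases "ennreal c * b")
     (auto simp: ereal_times_enn2ereal enn2ereal_ennreal top_ennreal.rep_eq simp flip: ennreal_plus)

text \<open>The bound depends on \<open>d\<close> only through the generated distribution, which
  reduces comparing decoders to comparing distributions.\<close>

lemma decoder_objective_le:
  assumes "0 \<le> \<gamma>"
  shows "decoder_objective p prior \<gamma> q d
    \<le> - enn2ereal (cross_entropy p (generated prior d)
        + ennreal \<gamma> * cross_entropy (generated prior d) (generated prior d))"
  unfolding decoder_objective_def uminus_enn2ereal_add[OF assms, symmetric]
  using assms by (intro add_mono ereal_mult_left_mono expect_elbo_le) simp

lemma decoder_objective_posterior:
  assumes "0 \<le> \<gamma>" "is_posterior prior d q"
  shows "decoder_objective p prior \<gamma> q d
    = - enn2ereal (cross_entropy p (generated prior d)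
        + ennreal \<gamma> * cross_entropy (generated prior d) (generated prior d))"
  unfolding decoder_objective_def uminus_enn2ereal_add[OF assms(1), symmetric]
  by (simp add: expect_elbo_posterior[OF assms(2)])

theorem theorem3:
  fixes pdata :: "'x pmf" and prior :: "'z pmf" and \<gamma> :: real
    and dstar :: "('x, 'z) decoder" and qstar :: "('x, 'z) encoder"
  assumes "\<gamma> \<ge> 0"
    and "is_arg_min
           (\<lambda>d :: ('x, 'z) decoder.
              KL pdata (generated prior d) + ereal \<gamma> * shannon_entropy (generated prior d))
           (\<lambda>d. True) dstar"
    and "is_posterior prior dstar qstar"
    and "\<forall>x. pmf pdata x > 0 \<longrightarrow> pmf (generated prior dstar) x \<le> sqrt (pmf pdata x)"
  shows "nash_equilibrium (encoder_objective pdata prior) (decoder_objective pdata prior \<gamma>)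
           qstar dstar"
proof -
  let ?r = "generated prior dstar"
  let ?F = "\<lambda>s. cross_entropy pdata s + ennreal \<gamma> * cross_entropy s s"
  have min: "?F ?r \<le> ?F s" for s
  proof (cases "cross_entropy pdata pdata = \<infinity>")
    case True
    then show ?thesis by (simp add: cross_entropy_eq_infinity)
  next
    case False
    \<comment> \<open>A decoder that ignores the latent variable generates any prescribed
      \<open>s\<close>, so minimality over decoders is minimality over all distributions.\<close>
    have const: "generated prior (\<lambda>_. s) = s"
      by (simp add: generated_def)
    have "\<not> KL pdata s + ereal \<gamma> * shannon_entropy s
        < KL pdata ?r + ereal \<gamma> * shannon_entropy ?r"
      using assms(2) unfolding is_arg_min_def by (metis const)
    then show ?thesis
      unfolding KL_plus_entropy[OF False assms(1)] using False
      by (cases "cross_entropy pdata pdata"; cases "?F ?r"; cases "?F s")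
         (auto simp: enn2ereal_ennreal top_ennreal.rep_eq top_unique intro: ennreal_leI)
  qed
  have supp: "set_pmf ?r \<subseteq> set_pmf pdata" if "cross_entropy pdata pdata \<noteq> \<infinity>"
  proof (rule minimizer_support[OF min])
    \<comment> \<open>The data distribution is a competitor of finite value, equal to
      \<open>(1 + \<gamma>)\<close> times its entropy.\<close>
    have "?F pdata \<noteq> \<infinity>"
      using that by (simp add: ennreal_mult_eq_top_iff)
    with min[of pdata] show "?F ?r \<noteq> \<infinity>"
      by (auto simp only: infinity_ennreal_def top_unique)
  qed
  have "encoder_objective pdata prior q dstar \<le> encoder_objective pdata prior qstar dstar" for q
    using assms(3,4) supp by (intro encoder_best_response) auto
  moreover have "decoder_objective pdata prior \<gamma> qstar d
      \<le> decoder_objective pdata prior \<gamma> qstar dstar" for d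
  proof -
    have "decoder_objective pdata prior \<gamma> qstar d \<le> - enn2ereal (?F (generated prior d))"
      by (rule decoder_objective_le[OF assms(1)])
    also have "\<dots> \<le> - enn2ereal (?F ?r)"
      using min by (simp flip: less_eq_ennreal.rep_eq)
    also have "\<dots> = decoder_objective pdata prior \<gamma> qstar dstar"
      by (rule decoder_objective_posterior[OF assms(1,3), symmetric])
    finally show ?thesis .
  qed
  ultimately show ?thesis
    by (simp add: nash_equilibrium_def)
qed

end
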